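(* Assume that the numbers $\pi,\zeta(3),\zeta(5),\zeta(7),\zeta(9),\dots$ are algebraically independent over $\mathbb{Q}$. Then for every integer $n>2$, the integral $I_n:=\iint_T \frac{(-\ln xy)^n}{xy}\,dx\,dy$ is not a rational multiple of $\zeta(n+2)$.
   Context: $T:=\{(x,y)\in[0,1]^2 : x+y\ge 1\}$; $\zeta$ is the Riemann zeta function. *)

theory Defs
  imports "HOL-Analysis.Analysis"
begin

text \<open>Riemann zeta at integer arguments s \<ge> 2 (where the series converges).\<close>
definition zeta_nat :: "nat \<Rightarrow> real" where
  "zeta_nat s = (\<Sum>k. 1 / real (Suc k) ^ s)"

text \<open>Algebraic independence over the rationals of a family of reals indexed by nat:
  every finite family of distinct monomials (exponent vectors supported in some {..<N})
  is linearly independent over the rationals.\<close>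
definition alg_indep_over_rat :: "(nat \<Rightarrow> real) \<Rightarrow> bool" where
  "alg_indep_over_rat x \<longleftrightarrow>
     (\<forall>(N::nat) (M::(nat \<Rightarrow> nat) set) (c::(nat \<Rightarrow> nat) \<Rightarrow> real).
        finite M \<longrightarrow> (\<forall>m\<in>M. \<forall>i\<ge>N. m i = 0) \<longrightarrow> (\<forall>m\<in>M. c m \<in> \<rat>) \<longrightarrow>
        (\<Sum>m\<in>M. c m * (\<Prod>i<N. x i ^ m i)) = 0 \<longrightarrow> (\<forall>m\<in>M. c m = 0))"

definition pi_odd_zetas :: "nat \<Rightarrow> real" where
  "pi_odd_zetas k = (if k = 0 then pi else zeta_nat (2 * k + 1))"

definition triangleT :: "(real \<times> real) set" where
  "triangleT = {(x, y). 0 \<le> x \<and> x \<le> 1 \<and> 0 \<le> y \<and> y \<le> 1 \<and> x + y \<ge> 1}"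

definition I_int :: "nat \<Rightarrow> real" where
  "I_int n = (LINT p:triangleT|lborel. (- ln (fst p * snd p)) ^ n / (fst p * snd p))"

end

theory Submission
  imports Defs
begin

text \<open>
  Put \<open>A t = \<Gamma>(1 - t)\<^sup>2 / \<Gamma>(1 - 2t)\<close>. Integrating \<open>(xy) powr (- t - 1)\<close> over the triangle gives
  \<open>(1 - A t) / t\<^sup>2\<close>, whose \<open>n\<close>-th Taylor coefficient is \<open>I\<^sub>n / n!\<close> by expanding in \<open>t\<close>. The logarithmic
  derivative of \<open>A\<close> is \<open>- (\<Sum>k\<ge>2. (2 ^ k - 2) \<zeta>(k) t ^ (k - 1))\<close>, which yields a recurrence for the
  coefficients of \<open>A\<close>; they are thus polynomials over the rationals in \<open>\<pi>, \<zeta>(3), \<zeta>(5), \<dots>\<close>, because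
  \<open>\<zeta>(2k)\<close> is a rational multiple of \<open>\<pi>\<close> to the power \<open>2k\<close>. With \<open>m = n + 2\<close>, the recurrence shows
  that the monomial \<open>\<pi>\<^sup>2 \<zeta>(m - 2)\<close> (for odd \<open>m\<close>) or \<open>\<zeta>(3) \<zeta>(m - 3)\<close> (for even \<open>m\<close>) has a positive
  coefficient in the \<open>m\<close>-th one, as all its contributions have the same sign; it is absent
  from \<open>\<zeta>(m)\<close>.
\<close>

section \<open>Power series and logarithmic derivatives\<close>

text \<open>Once the earlier coefficients vanish, dividing by \<open>t ^ n\<close> leaves a series
  with constant term \<open>a n\<close>, whose sum is continuous at 0 and zero to the right of it.
  The hypothesis is one-sided because the generating function of the integrals is computed for
  positive \<open>t\<close> only.\<close>

lemma powser_coeff_eq_0: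
  fixes a :: "nat \<Rightarrow> real"
  assumes r: "r > 0" and sm: "\<And>t. 0 < t \<Longrightarrow> t < r \<Longrightarrow> (\<lambda>n. a n * t ^ n) sums 0"
  shows "a n = 0"
proof (induction n rule: less_induct)
  case (less n)
  have s1: "(\<lambda>k. a (k + n) * t ^ k) sums 0" if t: "0 < t" "t < r" for t
  proof -
    have "(\<lambda>k. a (k + n) * t ^ (k + n)) sums (0 - (\<Sum>k<n. a k * t ^ k))"
      by (rule sums_split_initial_segment[OF sm[OF t]])
    also have "(\<Sum>k<n. a k * t ^ k) = 0"
      using less by simp
    finally have "(\<lambda>k. (a (k + n) * t ^ k) * t ^ n) sums (0 * t ^ n)"
      by (simp add: power_add mult.assoc)
    thus ?thesis
      using t by (subst (asm) sums_mult2_iff) auto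
  qed
  define f where "f t = (\<Sum>k. a (k + n) * t ^ k)" for t :: real
  \<comment> \<open>The limit theorem wants convergence on both sides of 0; it is inherited from a
    positive point \<open>u\<close> beyond \<open>\<bar>t\<bar>\<close>.\<close>
  have sf: "(\<lambda>k. a (k + n) * t ^ k) sums f t" if "norm t < r" for t
  proof -
    define u where "u = (\<bar>t\<bar> + r) / 2"
    have u: "\<bar>t\<bar> < u" "u < r" "0 < u" using that r by (auto simp: u_def)
    hence "summable (\<lambda>k. a (k + n) * u ^ k)" using s1[of u] by (auto simp: sums_iff)
    hence "summable (\<lambda>k. a (k + n) * t ^ k)"
      by (rule powser_inside) (use u in auto)
    thus ?thesis by (simp add: f_def summable_sums)
  qed
  have "(f \<longlongrightarrow> a (0 + n)) (at 0)"
    by (rule powser_limit_0[OF r sf])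
  hence "(f \<longlongrightarrow> a n) (at_right 0)"
    by (simp add: filterlim_at_split)
  moreover have "eventually (\<lambda>t. f t = 0) (at_right 0)"
    using eventually_at_right_real[OF r]
    by eventually_elim (auto simp: f_def dest!: s1 intro: sums_unique[symmetric])
  ultimately have "((\<lambda>_. 0) \<longlongrightarrow> a n) (at_right (0::real))"
    by (rule Lim_transform_eventually)
  thus "a n = 0"
    by (simp add: tendsto_const_iff)
qed

text \<open>Compares coefficients in \<open>f' = h * f\<close>: termwise differentiation on the
  left, the Cauchy product on the right, and the difference \<open>d\<close> is killed by the
  preceding lemma.\<close>

lemma log_deriv_coeff_rec:
  fixes a b :: "nat \<Rightarrow> real"
  assumes r: "r > 0"
    and f: "\<And>t. 0 < t \<Longrightarrow> t < r \<Longrightarrow> (\<lambda>n. a n * t ^ n) sums f t"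
    and h: "\<And>t. 0 < t \<Longrightarrow> t < r \<Longrightarrow> (\<lambda>n. b n * t ^ n) sums h t"
    and der: "\<And>t. 0 < t \<Longrightarrow> t < r \<Longrightarrow> (f has_real_derivative h t * f t) (at t)"
  shows "real (Suc n) * a (Suc n) = (\<Sum>j\<le>n. b j * a (n - j))"
proof -
  define d where "d n = diffs a n - (\<Sum>j\<le>n. b j * a (n - j))" for n
  have "d n = 0"
  proof (rule powser_coeff_eq_0[OF r])
    fix t :: real assume t: "0 < t" "t < r"
    obtain u where u: "t < u" "u < r" using t dense by blast
    have su: "summable (\<lambda>n. a n * u ^ n)" "summable (\<lambda>n. b n * u ^ n)"
      using f[of u] h[of u] t u by (auto simp: sums_iff)
    have nt: "summable (\<lambda>n. norm (a n * t ^ n))" "summable (\<lambda>n. norm (b n * t ^ n))"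
      by (rule powser_insidea[OF su(1)] powser_insidea[OF su(2)]; use t u in simp)+
    have "(\<lambda>n. \<Sum>i\<le>n. (b i * t ^ i) * (a (n - i) * t ^ (n - i))) sums
            ((\<Sum>n. b n * t ^ n) * (\<Sum>n. a n * t ^ n))"
      by (rule Cauchy_product_sums[OF nt(2) nt(1)])
    also have "(\<lambda>n. \<Sum>i\<le>n. (b i * t ^ i) * (a (n - i) * t ^ (n - i))) =
                 (\<lambda>n. (\<Sum>i\<le>n. b i * a (n - i)) * t ^ n)"
      unfolding sum_distrib_right
      by (intro ext sum.cong refl) (auto simp: power_add[symmetric] algebra_simps)
    also have "(\<Sum>n. b n * t ^ n) * (\<Sum>n. a n * t ^ n) = h t * f t"
      using f[OF t] h[OF t] by (simp add: sums_iff)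
    finally have P: "(\<lambda>n. (\<Sum>i\<le>n. b i * a (n - i)) * t ^ n) sums (h t * f t)" .
    have "((\<lambda>x. \<Sum>n. a n * x ^ n) has_real_derivative (\<Sum>n. diffs a n * t ^ n)) (at t)"
      by (rule termdiffs_strong[OF su(1)]) (use t u in auto)
    moreover have "eventually (\<lambda>x. (\<Sum>n. a n * x ^ n) = f x) (nhds t)"
      using eventually_nhds_in_open[of "{0<..<r}" t] t f
      by (auto elim!: eventually_mono simp: sums_iff)
    ultimately have "(f has_real_derivative (\<Sum>n. diffs a n * t ^ n)) (at t)"
      by (subst (asm) DERIV_cong_ev[OF refl _ refl])
    hence "(\<Sum>n. diffs a n * t ^ n) = h t * f t"
      using der[OF t] DERIV_unique by blast
    moreover have "summable (\<lambda>n. diffs a n * t ^ n)"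
      by (rule termdiff_converges[of t u]) (use t u in \<open>auto intro: powser_inside[OF su(1)]\<close>)
    ultimately have "(\<lambda>n. diffs a n * t ^ n) sums (h t * f t)"
      by (simp add: sums_iff)
    from sums_diff[OF this P] show "(\<lambda>n. d n * t ^ n) sums 0"
      by (simp add: d_def algebra_simps)
  qed
  thus ?thesis by (simp add: d_def diffs_def)
qed

section \<open>Positivity of zeta values and the power series of Digamma at 1\<close>

lemma zeta_nat_sums: "s \<ge> 2 \<Longrightarrow> (\<lambda>k. 1 / real (Suc k) ^ s) sums zeta_nat s"
  using summable_Suc_iff[of "\<lambda>k. inverse (real k ^ s)"] inverse_power_summable[of s, where 'a = real]
  by (simp add: zeta_nat_def summable_sums inverse_eq_divide)

lemma zeta_nat_pos: "s \<ge> 2 \<Longrightarrow> zeta_nat s > 0"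
  using zeta_nat_sums[of s] unfolding zeta_nat_def
  by (intro suminf_pos) (auto simp: sums_iff)

text \<open>The double series with terms \<open>t ^ Suc j / real (Suc k) ^ (j + 2)\<close> converges
  absolutely. Summed over \<open>j\<close> first, it gives geometric series that add up to the
  Digamma series; summed over \<open>k\<close> first, it gives the zeta values.\<close>

lemma zeta_power_sums_Digamma:
  fixes t :: real
  assumes t: "\<bar>t\<bar> < 1"
  shows "(\<lambda>j. zeta_nat (j + 2) * t ^ Suc j) sums (- euler_mascheroni - Digamma (1 - t))"
proof -
  define f where "f t = (\<lambda>(k, j). t ^ Suc j / real (Suc k) ^ (j + 2))" for t :: real
  have row: "(\<lambda>j. f s (k, j)) sums (s / (real (Suc k) * (real (Suc k) - s)))"
    if s: "\<bar>s\<bar> < 1" for s k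
  proof -
    have lt: "norm (s / real (Suc k)) < 1" using s by (auto simp: divide_simps)
    have "(\<lambda>j. s / real (Suc k) ^ 2 * (s / real (Suc k)) ^ j) sums
            (s / real (Suc k) ^ 2 * (1 / (1 - s / real (Suc k))))"
      by (intro sums_mult geometric_sums lt)
    also have "s / real (Suc k) ^ 2 * (1 / (1 - s / real (Suc k))) =
                 s / (real (Suc k) * (real (Suc k) - s))"
      using s by (simp add: divide_simps power2_eq_square)
    finally show ?thesis
      by (simp add: f_def power_divide power_add mult_ac power2_eq_square)
  qed
  \<comment> \<open>Hence the row sums at \<open>\<bar>t\<bar>\<close> also settle absolute
    convergence at \<open>t\<close>.\<close>
  have absf: "norm (f t p) = f \<bar>t\<bar> p" for p
    by (auto simp: f_def abs_mult power_abs split: prod.splits)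
  have hs_abs: "((\<lambda>j. f \<bar>t\<bar> (k, j)) has_sum (\<bar>t\<bar> / (real (Suc k) * (real (Suc k) - \<bar>t\<bar>)))) UNIV" for k
    by (rule sums_nonneg_imp_has_sum[OF row]) (use t in \<open>auto simp: f_def\<close>)
  have "(\<lambda>p. norm (f t p)) summable_on (UNIV \<times> UNIV)"
    unfolding Infinite_Sum.abs_summable_on_Sigma_iff
  proof (intro conjI ballI)
    show "(\<lambda>j. norm (f t (k, j))) summable_on UNIV" for k
      unfolding absf using hs_abs by (rule has_sum_imp_summable)
    have inf: "infsum (\<lambda>j. norm (f t (k, j))) UNIV = \<bar>t\<bar> / (real (Suc k) * (real (Suc k) - \<bar>t\<bar>))" for k
      unfolding absf by (rule infsumI[OF hs_abs])
    have "summable (\<lambda>k. 1 / (1 - \<bar>t\<bar>) * (1 / real (Suc k) ^ 2))"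
      using zeta_nat_sums[of 2] by (intro summable_mult) (auto simp: sums_iff)
    hence "summable (\<lambda>k. \<bar>t\<bar> / (real (Suc k) * (real (Suc k) - \<bar>t\<bar>)))"
    proof (rule summable_comparison_test'[where N = 0])
      fix k :: nat
      have "\<bar>t\<bar> * (real k + 1) \<ge> \<bar>t\<bar> * 1" by (intro mult_left_mono) auto
      \<comment> \<open>This bound allows comparison of the row sums with a multiple of the series
        for zeta(2).\<close>
      hence le: "real (Suc k) * (1 - \<bar>t\<bar>) \<le> real (Suc k) - \<bar>t\<bar>"
        by (simp add: algebra_simps)
      have "\<bar>t\<bar> / (real (Suc k) * (real (Suc k) - \<bar>t\<bar>)) \<le> 1 / (real (Suc k) * (real (Suc k) * (1 - \<bar>t\<bar>)))"
        using t by (intro frac_le mult_left_mono le) auto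
      thus "norm (\<bar>t\<bar> / (real (Suc k) * (real (Suc k) - \<bar>t\<bar>))) \<le> 1 / (1 - \<bar>t\<bar>) * (1 / real (Suc k) ^ 2)"
        using t by (simp add: power2_eq_square mult_ac)
    qed
    hence "summable (\<lambda>k. norm (infsum (\<lambda>j. norm (f t (k, j))) UNIV))"
      unfolding inf using t by simp
    thus "(\<lambda>k. norm (infsum (\<lambda>j. norm (f t (k, j))) UNIV)) summable_on UNIV"
      using norm_summable_imp_summable_on[of "\<lambda>k. norm (infsum (\<lambda>j. norm (f t (k, j))) UNIV)"]
      by simp
  qed
  hence "f t summable_on (UNIV \<times> UNIV)" by (rule Infinite_Sum.abs_summable_summable)
  then obtain S where S: "(f t has_sum S) (UNIV \<times> UNIV)" by (auto simp: summable_on_def)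
  have nrow: "summable (\<lambda>j. norm (f t (k, j)))" for k
    unfolding absf using row[of "\<bar>t\<bar>" k] t by (auto simp: sums_iff)
  have "((\<lambda>k. t / (real (Suc k) * (real (Suc k) - t))) has_sum S) UNIV"
    by (rule has_sum_SigmaD[OF S]) (rule norm_summable_imp_has_sum[OF nrow row[OF t]])
  hence "(\<lambda>k. t / (real (Suc k) * (real (Suc k) - t))) sums S" by (rule has_sum_imp_sums)
  moreover have "(\<lambda>k. inverse (real (Suc k)) - inverse (1 - t + real k)) sums
                   (Digamma (1 - t) + euler_mascheroni)"
    using summable_Digamma[of "1 - t"] t by (simp add: Digamma_def summable_sums)
  hence "(\<lambda>k. - (inverse (real (Suc k)) - inverse (1 - t + real k))) sums
                   (- (Digamma (1 - t) + euler_mascheroni))"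
    by (rule sums_minus)
  moreover have "- (inverse (real (Suc k)) - inverse (1 - t + real k)) =
                   t / (real (Suc k) * (real (Suc k) - t))" for k
    using t by (simp add: field_simps)
  ultimately have S_eq: "S = - euler_mascheroni - Digamma (1 - t)"
    by (simp add: sums_iff)
  have col: "(\<lambda>k. f t (k, j)) sums (zeta_nat (j + 2) * t ^ Suc j)" for j
    using sums_mult2[OF zeta_nat_sums[of "j + 2"], of "t ^ Suc j"] by (simp add: f_def)
  have ncol: "summable (\<lambda>k. norm (f t (k, j)))" for j
    using summable_mult2[OF sums_summable[OF zeta_nat_sums[of "j + 2"]], of "\<bar>t\<bar> ^ Suc j"]
    unfolding absf by (simp add: f_def)
  have "((\<lambda>(j, k). f t (k, j)) has_sum S) (UNIV \<times> UNIV)"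
    using S by (subst (asm) has_sum_swap) simp
  hence "((\<lambda>j. zeta_nat (j + 2) * t ^ Suc j) has_sum S) UNIV"
    by (rule has_sum_SigmaD) (simp only: prod.case, rule norm_summable_imp_has_sum[OF ncol col])
  thus ?thesis unfolding S_eq by (rule has_sum_imp_sums)
qed

section \<open>Zeta values as Taylor coefficients\<close>

text \<open>The constant term is separate because \<open>zeta_nat 1\<close> is the value of a
  divergent \<open>suminf\<close>.\<close>

lemma Digamma_power_sums:
  fixes t :: real
  assumes "\<bar>t\<bar> < 1"
  shows "(\<lambda>j. (if j = 0 then - euler_mascheroni else - zeta_nat (j + 1)) * t ^ j) sums Digamma (1 - t)"
proof -
  let ?f = "\<lambda>j. (if j = 0 then - euler_mascheroni else - zeta_nat (j + 1)) * t ^ j"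
  have "(\<lambda>j. ?f (Suc j)) sums (- (- euler_mascheroni - Digamma (1 - t)))"
    using sums_minus[OF zeta_power_sums_Digamma[OF assms]] by simp
  hence "?f sums (- (- euler_mascheroni - Digamma (1 - t)) + ?f 0)"
    by (rule sums_Suc)
  thus ?thesis by simp
qed

text \<open>The factor \<open>t\<close> turns \<open>rGamma (1 + t)\<close> into
  \<open>rGamma t\<close>, which reduces the claim to the complex reflection formula.\<close>

lemma rGamma_reflection_real:
  fixes t :: real
  shows "t * (rGamma (1 + t) * rGamma (1 - t)) = sin (pi * t) / pi"
proof -
  have "complex_of_real (rGamma t * rGamma (1 - t)) = complex_of_real (sin (pi * t) / pi)"
    using rGamma_reflection_complex[of "of_real t"]
    by (simp flip: rGamma_complex_of_real sin_of_real)
  hence "rGamma t * rGamma (1 - t) = sin (pi * t) / pi"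
    by (simp only: of_real_eq_iff)
  thus ?thesis
    using rGamma_plus1[of t] by (simp add: add.commute flip: mult.assoc)
qed

text \<open>The coefficient recurrence for \<open>sin (pi * t) / (pi * t)\<close>, written by
  reflection as a product of two \<open>rGamma\<close> values. Its logarithmic derivative is a
  difference of Digamma values at \<open>1 - t\<close> and \<open>1 + t\<close>, so the even powers
  cancel and the odd ones double.\<close>

lemma sin_coeff_zeta_rec:
  "real (Suc k) * (sin_coeff (Suc (Suc k)) * pi ^ Suc k) =
     (\<Sum>j\<le>k. (if odd j then - 2 * zeta_nat (Suc j) else 0) * (sin_coeff (Suc (k - j)) * pi ^ (k - j)))"
proof (rule log_deriv_coeff_rec[where r = 1 and f = "\<lambda>t. rGamma (1 + t) * rGamma (1 - t)"
         and h = "\<lambda>t. Digamma (1 - t) - Digamma (1 + t)"])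
  fix t :: real assume t: "0 < t" "t < 1"
  have "(\<lambda>n. sin_coeff n * (pi * t) ^ n) sums sin (pi * t)"
    using sin_converges[of "pi * t"] by simp
  hence "(\<lambda>n. sin_coeff (Suc n) * (pi * t) ^ Suc n) sums sin (pi * t)"
    by (subst sums_Suc_iff) simp
  hence "(\<lambda>n. sin_coeff (Suc n) * (pi * t) ^ Suc n / (pi * t)) sums (sin (pi * t) / (pi * t))"
    by (rule sums_divide)
  also have "(\<lambda>n. sin_coeff (Suc n) * (pi * t) ^ Suc n / (pi * t)) =
               (\<lambda>n. sin_coeff (Suc n) * pi ^ n * t ^ n)"
    using t by (simp add: power_mult_distrib mult.assoc)
  also have "sin (pi * t) / (pi * t) = rGamma (1 + t) * rGamma (1 - t)"
    using rGamma_reflection_real[of t] t by (simp add: field_simps)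
  finally show "(\<lambda>n. sin_coeff (Suc n) * pi ^ n * t ^ n) sums (rGamma (1 + t) * rGamma (1 - t))" .
  have "(\<lambda>j. (if j = 0 then - euler_mascheroni else - zeta_nat (j + 1)) * t ^ j -
             (if j = 0 then - euler_mascheroni else - zeta_nat (j + 1)) * (- t) ^ j) sums
           (Digamma (1 - t) - Digamma (1 - (- t)))"
    using t by (intro sums_diff Digamma_power_sums) auto
  also have "(\<lambda>j. (if j = 0 then - euler_mascheroni else - zeta_nat (j + 1)) * t ^ j -
               (if j = 0 then - euler_mascheroni else - zeta_nat (j + 1)) * (- t) ^ j) =
             (\<lambda>j. (if odd j then - 2 * zeta_nat (Suc j) else 0) * t ^ j)"
    by (rule ext) (auto simp: power_minus_odd elim!: oddE)
  finally show "(\<lambda>j. (if odd j then - 2 * zeta_nat (Suc j) else 0) * t ^ j) sums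
                  (Digamma (1 - t) - Digamma (1 + t))" by simp
  have "1 - t \<notin> \<int>\<^sub>\<le>\<^sub>0" "1 + t \<notin> \<int>\<^sub>\<le>\<^sub>0" using t by (auto dest: nonpos_Ints_nonpos)
  thus "((\<lambda>t. rGamma (1 + t) * rGamma (1 - t)) has_real_derivative
          (Digamma (1 - t) - Digamma (1 + t)) * (rGamma (1 + t) * rGamma (1 - t))) (at t)"
    by (auto intro!: derivative_eq_intros simp: algebra_simps)
qed simp_all

text \<open>Solving the sine recurrence for its last term expresses each zeta value by earlier ones;
  dividing by the matching power of \<open>pi\<close> leaves rational data only.\<close>

lemma even_zeta_rat_multiple_pi_power:
  assumes "even k" "k \<ge> 2"
  shows "zeta_nat k / pi ^ k \<in> \<rat>"
proof -
  define d where "d j = (if odd j then - 2 * zeta_nat (Suc j) else 0)" for j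
  have sc: "sin_coeff n \<in> \<rat>" for n
  proof -
    have "(fact n :: real) \<in> \<rat>" by (metis Rats_of_nat of_nat_fact)
    thus ?thesis by (auto simp: sin_coeff_def intro!: Rats_divide Rats_power)
  qed
  have d_rat: "d j / pi ^ Suc j \<in> \<rat>" for j
  proof (induction j rule: less_induct)
    case (less j)
    have "real (Suc j) * (sin_coeff (Suc (Suc j)) * pi ^ Suc j) =
            (\<Sum>i\<le>j. d i * (sin_coeff (Suc (j - i)) * pi ^ (j - i)))"
      unfolding d_def by (rule sin_coeff_zeta_rec)
    \<comment> \<open>The term \<open>i = j\<close> carries \<open>sin_coeff 1 = 1\<close>, so
      \<open>d j\<close> can be isolated.\<close>
    also have "\<dots> = d j + (\<Sum>i<j. d i * (sin_coeff (Suc (j - i)) * pi ^ (j - i)))"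
      by (simp add: lessThan_Suc_atMost[symmetric] sin_coeff_def)
    finally have "d j / pi ^ Suc j = real (Suc j) * sin_coeff (Suc (Suc j)) -
        (\<Sum>i<j. d i * (sin_coeff (Suc (j - i)) * pi ^ (j - i))) / pi ^ Suc j"
      by (simp add: field_simps)
    also have "(\<Sum>i<j. d i * (sin_coeff (Suc (j - i)) * pi ^ (j - i))) / pi ^ Suc j =
                 (\<Sum>i<j. d i / pi ^ Suc i * sin_coeff (Suc (j - i)))"
      unfolding sum_divide_distrib
      by (intro sum.cong refl) (simp add: power_add[symmetric] field_simps flip: power_Suc)
    also have "real (Suc j) * sin_coeff (Suc (Suc j)) - \<dots> \<in> \<rat>"
      by (intro Rats_diff Rats_mult Rats_sum Rats_of_nat sc less.IH) auto
    finally show ?case .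
  qed
  from assms obtain j where j: "k = Suc j" "odd j" by (cases k) auto
  have "d j / pi ^ Suc j / (- 2) \<in> \<rat>"
    by (intro Rats_divide d_rat) auto
  thus ?thesis using j by (simp add: d_def)
qed

section \<open>The quotient \<open>A\<close> of Gamma values and its logarithmic derivative\<close>

definition gamma_quot :: "real \<Rightarrow> real" where
  "gamma_quot t = Gamma (1 - t) ^ 2 * rGamma (1 - 2 * t)"

lemma gamma_quot_deriv:
  assumes "0 < t" "t < 1 / 2"
  shows "(gamma_quot has_real_derivative (2 * Digamma (1 - 2 * t) - 2 * Digamma (1 - t)) * gamma_quot t) (at t)"
proof -
  have "1 - t \<notin> \<int>\<^sub>\<le>\<^sub>0" "1 - 2 * t \<notin> \<int>\<^sub>\<le>\<^sub>0" using assms by (auto dest: nonpos_Ints_nonpos)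
  thus ?thesis unfolding gamma_quot_def[abs_def]
    by (auto intro!: derivative_eq_intros simp: algebra_simps power2_eq_square)
qed

text \<open>The powers of 2 come from evaluating the Digamma series at \<open>2 * t\<close>. At
  \<open>j = 0\<close> the Euler constants cancel and the factor \<open>2 ^ Suc 0 - 2\<close> is 0,
  so the value of \<open>zeta_nat 1\<close> is harmless.\<close>

lemma gamma_quot_log_deriv_sums:
  assumes "0 < t" "t < 1 / 2"
  shows "(\<lambda>j. - (2 ^ Suc j - 2) * zeta_nat (Suc j) * t ^ j) sums
           (2 * Digamma (1 - 2 * t) - 2 * Digamma (1 - t))"
proof -
  let ?c = "\<lambda>j. if j = 0 then - euler_mascheroni else - zeta_nat (j + 1)"
  have "(\<lambda>j. 2 * (?c j * (2 * t) ^ j) - 2 * (?c j * t ^ j)) sums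
          (2 * Digamma (1 - 2 * t) - 2 * Digamma (1 - t))"
    using assms by (intro sums_diff sums_mult Digamma_power_sums) auto
  also have "(\<lambda>j. 2 * (?c j * (2 * t) ^ j) - 2 * (?c j * t ^ j)) =
               (\<lambda>j. - (2 ^ Suc j - 2) * zeta_nat (Suc j) * t ^ j)"
    by (rule ext) (auto simp: power_mult_distrib algebra_simps)
  finally show ?thesis .
qed

lemma gamma_quot_coeff_rec:
  assumes "\<And>t. 0 < t \<Longrightarrow> t < 1 / 2 \<Longrightarrow> (\<lambda>n. g n * t ^ n) sums gamma_quot t"
  shows "real (Suc n) * g (Suc n) =
           (\<Sum>j\<le>n. - (2 ^ Suc j - 2) * zeta_nat (Suc j) * g (n - j))"
  by (rule log_deriv_coeff_rec[where r = "1 / 2", OF _ assms gamma_quot_log_deriv_sums gamma_quot_deriv]) auto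

section \<open>The generating function of the integrals\<close>

text \<open>The integrand is what remains of \<open>(x * y) powr (- r - 1)\<close> after integrating
  over \<open>y\<close> from \<open>1 - x\<close> to 1. It splits into an exact derivative and a
  convergent Beta integrand.\<close>

lemma has_integral_triangle_slices:
  fixes r :: real
  assumes r: "0 < r" "r < 1 / 2"
  shows "((\<lambda>x. x powr (- r - 1) * (((1 - x) powr (- r) - 1) / r)) has_integral
           (1 - gamma_quot r) / r ^ 2) {0<..<1}"
proof -
  \<comment> \<open>\<open>H\<close> comes from splitting off the Beta integrand by means of \<open>1 = (1 - x) + x\<close>:
    the integral of \<open>x powr (- r - 1) * (1 - x) powr (- r)\<close> alone diverges.\<close>
  define H where "H x = x powr (- r) * (1 - (1 - x) powr (1 - r)) / r" for x :: real
  define H' where "H' x = - (x powr (- r - 1)) * (1 - (1 - x) powr (1 - r)) +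
                    x powr (- r) * ((1 - r) * (1 - x) powr (- r)) / r" for x :: real
  \<comment> \<open>The factor \<open>x powr (- r)\<close> blows up at 0, but
    \<open>1 - (1 - x) powr (1 - r)\<close> is at most \<open>x\<close>, so \<open>H\<close> is
    squeezed to 0.\<close>
  have H_cont_0: "(H \<longlongrightarrow> H 0) (at 0 within {0..1})"
  proof (rule tendsto_sandwich)
    have ev: "eventually (\<lambda>x. x \<in> {0<..<1}) (at 0 within {0..1::real})"
    proof -
      have "eventually (\<lambda>x. x \<in> {- 1<..<1}) (at 0 within {0..1::real})"
        by (intro eventually_at_topological[THEN iffD2] exI[of _ "{- 1<..<1}"]) auto
      moreover have "eventually (\<lambda>x. x \<in> {0..1} \<and> x \<noteq> 0) (at 0 within {0..1::real})"
        by (auto simp: eventually_at_filter)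
      ultimately show ?thesis by eventually_elim auto
    qed
    have bounds: "0 \<le> H x \<and> H x \<le> x powr (1 - r) / r" if x: "x \<in> {0<..<1}" for x
    proof -
      have "(1 - x) powr (1 - r) \<le> 1" using x r by (intro powr_le1) auto
      moreover have "(1 - x) powr 1 \<le> (1 - x) powr (1 - r)"
        using x r by (intro powr_mono') auto
      ultimately have "x powr (- r) * (1 - (1 - x) powr (1 - r)) \<le> x powr (- r) * x"
                      "0 \<le> x powr (- r) * (1 - (1 - x) powr (1 - r))"
        using x by (auto intro!: mult_left_mono mult_nonneg_nonneg)
      moreover have "x powr (- r) * x = x powr (1 - r)"
        using x powr_add[of x "- r" 1] by simp
      ultimately show ?thesis using r by (simp add: H_def divide_right_mono)
    qed
    show "eventually (\<lambda>x. 0 \<le> H x) (at 0 within {0..1})"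
         "eventually (\<lambda>x. H x \<le> x powr (1 - r) / r) (at 0 within {0..1})"
      using ev by (eventually_elim; use bounds in blast)+
    have "continuous_on {0..1} (\<lambda>x. x powr (1 - r) / r)"
      using r by (intro continuous_intros continuous_on_powr') auto
    thus "((\<lambda>x. x powr (1 - r) / r) \<longlongrightarrow> H 0) (at 0 within {0..1})"
      by (auto simp: continuous_on_def H_def dest!: bspec[of _ _ 0])
    show "((\<lambda>x. 0) \<longlongrightarrow> H 0) (at 0 within {0..1})" by (simp add: H_def)
  qed
  have H_cont: "continuous_on {0..1} H"
    unfolding continuous_on_eq_continuous_within
  proof
    fix x :: real assume x: "x \<in> {0..1}"
    show "continuous (at x within {0..1}) H"
    proof (cases "x = 0")
      case True
      thus ?thesis using H_cont_0 by (simp add: continuous_within)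
    next
      case False
      have "continuous_on {0<..1} H" unfolding H_def
        using r by (intro continuous_intros continuous_on_powr') auto
      hence "continuous (at x within {0<..1}) H"
        using x False by (auto simp: continuous_on_eq_continuous_within)
      moreover have "at x within {0<..1} = at x within {0..1}"
        using x False by (intro at_within_nhd[of _ "{0<..}"]) auto
      ultimately show ?thesis by (simp add: continuous_within)
    qed
  qed
  have "(H' has_integral (H 1 - H 0)) {0..1}"
  proof (rule fundamental_theorem_of_calculus_interior[OF _ H_cont])
    fix x :: real assume x: "x \<in> {0<..<1}"
    have "(H has_real_derivative H' x) (at x)"
    proof -
      have d1: "((\<lambda>x. x powr (- r)) has_real_derivative (- r * x powr (- r - 1))) (at x)"
        using x by (intro has_real_derivative_powr) auto
      have "((\<lambda>z. z powr (1 - r)) has_real_derivative ((1 - r) * (1 - x) powr (1 - r - 1))) (at (1 - x))"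
        using x by (intro has_real_derivative_powr) auto
      hence d2: "((\<lambda>x. (1 - x) powr (1 - r)) has_real_derivative
                   ((1 - r) * (1 - x) powr (1 - r - 1) * (- 1))) (at x)"
        by (rule DERIV_chain2) (auto intro!: derivative_eq_intros)
      have "(H has_real_derivative
              ((- r * x powr (- r - 1)) * (1 - (1 - x) powr (1 - r)) +
               (0 - (1 - r) * (1 - x) powr (1 - r - 1) * (- 1)) * x powr (- r)) / r) (at x)"
        unfolding H_def by (intro DERIV_cdivide DERIV_mult d1 DERIV_diff d2 DERIV_const)
      thus ?thesis using r by (simp add: H'_def add_divide_distrib diff_divide_distrib mult_ac)
    qed
    thus "(H has_vector_derivative H' x) (at x)"
      by (rule has_real_derivative_iff_has_vector_derivative[THEN iffD1])
  qed auto
  hence I1: "(H' has_integral (1 / r)) {0<..<1}"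
    using r by (simp add: has_integral_Icc_iff_Ioo H_def)
  have I2: "((\<lambda>x. x powr (- r) * (1 - x) powr (- r)) has_integral Beta (1 - r) (1 - r)) {0<..<1}"
    using has_integral_Beta_real[of "1 - r" "1 - r"] r by (simp add: has_integral_Icc_iff_Ioo)
  \<comment> \<open>The coefficient is chosen so that
    \<open>(1 - r) / r + (2 * r - 1) / r = 1\<close>: the Beta integrands then combine to cancel the
    \<open>x\<close> part of the factor \<open>1 - x\<close> in
    \<open>(1 - x) powr (1 - r)\<close>.\<close>
  have "((\<lambda>x. (H' x + (2 * r - 1) / r * (x powr (- r) * (1 - x) powr (- r))) / r) has_integral
           (1 / r + (2 * r - 1) / r * Beta (1 - r) (1 - r)) / r) {0<..<1}"
    by (intro has_integral_divide has_integral_add I1 has_integral_mult_right I2)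
  also have "(1 / r + (2 * r - 1) / r * Beta (1 - r) (1 - r)) / r = (1 - gamma_quot r) / r ^ 2"
  proof -
    have "rGamma (1 - 2 * r) = (1 - 2 * r) * rGamma (2 - 2 * r)"
      using rGamma_plus1[of "1 - 2 * r"] by (simp add: add.commute)
    hence "gamma_quot r = (1 - 2 * r) * Beta (1 - r) (1 - r)"
      by (simp add: gamma_quot_def Beta_altdef power2_eq_square)
    thus ?thesis using r by (simp add: field_simps power2_eq_square)
  qed
  finally show ?thesis
  proof (rule has_integral_eq[rotated])
    fix x :: real assume x: "x \<in> {0<..<1}"
    define X Y where "X = x powr (- r - 1)" and "Y = (1 - x) powr (- r)"
    have X: "x powr (- r) = X * x" using x powr_add[of x "- r - 1" 1] by (simp add: X_def)
    have Y: "(1 - x) powr (1 - r) = Y * (1 - x)"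
      using x powr_add[of "1 - x" "- r" 1] by (simp add: Y_def)
    show "(H' x + (2 * r - 1) / r * (x powr (- r) * (1 - x) powr (- r))) / r =
                       x powr (- r - 1) * (((1 - x) powr (- r) - 1) / r)"
      using r unfolding H'_def X_def[symmetric] Y_def[symmetric] X Y
      by (simp add: field_simps)
  qed
qed

section \<open>Integration over the triangle and expansion under the integral sign\<close>

lemma triangle_slice_nonneg:
  fixes r x :: real
  assumes "0 < r" "x \<in> {0<..<1}"
  shows "0 \<le> x powr (- r - 1) * (((1 - x) powr (- r) - 1) / r)"
proof -
  have "(1 - x) powr 0 \<le> (1 - x) powr (- r)" using assms by (intro powr_mono') auto
  thus ?thesis using assms by simp
qed

lemma triangleT_measurable [measurable]: "triangleT \<in> sets (borel \<Otimes>\<^sub>M borel)"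
proof -
  have "triangleT = {p. 0 \<le> fst p \<and> fst p \<le> 1 \<and> 0 \<le> snd p \<and> snd p \<le> 1 \<and> 1 \<le> fst p + snd p}"
    by (auto simp: triangleT_def)
  also have "closed \<dots>"
    by (intro closed_Collect_conj closed_Collect_le continuous_intros)
  hence "\<dots> \<in> sets borel" by (rule borel_closed)
  finally show ?thesis unfolding borel_prod .
qed

lemma nn_integral_triangle_powr:
  fixes r :: real
  assumes r: "0 < r" "r < 1 / 2"
  shows "(\<integral>\<^sup>+p. ennreal (indicator triangleT p * (fst p * snd p) powr (- r - 1)) \<partial>lborel) =
           ennreal ((1 - gamma_quot r) / r ^ 2)"
proof -
  let ?f = "\<lambda>p. ennreal (indicator triangleT p * (fst p * snd p) powr (- r - 1))"
  have meas: "?f \<in> borel_measurable (lborel \<Otimes>\<^sub>M lborel)"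
    unfolding lborel_prod measurable_lborel2 borel_prod[symmetric] by measurable
  \<comment> \<open>At \<open>x = 1\<close> the inner integral is infinite; the two end points are
    later discarded as null sets.\<close>
  have slice: "(\<integral>\<^sup>+y. ?f (x, y) \<partial>lborel) =
      ennreal (x powr (- r - 1) * (((1 - x) powr (- r) - 1) / r)) * indicator {0<..<1} x"
    if "x \<noteq> 0" "x \<noteq> 1" for x
  proof (cases "x \<in> {0<..<1}")
    case True
    let ?F = "\<lambda>y. - (x powr (- r - 1) * (y powr (- r) / r))"
    have "(\<integral>\<^sup>+y. ?f (x, y) \<partial>lborel) =
            (\<integral>\<^sup>+y. ennreal (x powr (- r - 1) * y powr (- r - 1)) * indicator {1 - x..1} y \<partial>lborel)"
      using True by (intro nn_integral_cong) (auto simp: triangleT_def indicator_def powr_mult)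
    also have "\<dots> = ennreal (?F 1 - ?F (1 - x))"
    proof (rule nn_integral_FTC_Icc)
      fix y assume "y \<in> {1 - x..1}"
      hence "y > 0" using True by auto
      thus "(?F has_real_derivative (x powr (- r - 1) * y powr (- r - 1))) (at y)"
        using r by (auto intro!: derivative_eq_intros)
    qed (use True in auto)
    also have "?F 1 - ?F (1 - x) = x powr (- r - 1) * (((1 - x) powr (- r) - 1) / r)"
      using r by (simp add: field_simps)
    finally show ?thesis using True by simp
  next
    case False
    hence "?f (x, y) = 0" for y using that by (auto simp: triangleT_def indicator_def)
    hence "(\<integral>\<^sup>+y. ?f (x, y) \<partial>lborel) = (\<integral>\<^sup>+y. 0 \<partial>(lborel :: real measure))"
      by (rule nn_integral_cong)
    thus ?thesis using False by simp
  qed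
  have "integral\<^sup>N lborel ?f = (\<integral>\<^sup>+x. \<integral>\<^sup>+y. ?f (x, y) \<partial>lborel \<partial>lborel)"
    using lborel.nn_integral_fst[OF meas] by (simp only: lborel_prod)
  also have "\<dots> = (\<integral>\<^sup>+x. ennreal (x powr (- r - 1) * (((1 - x) powr (- r) - 1) / r)) * indicator {0<..<1} x \<partial>lborel)"
  proof (rule nn_integral_cong_AE)
    show "AE x in lborel. (\<integral>\<^sup>+y. ?f (x, y) \<partial>lborel) =
      ennreal (x powr (- r - 1) * (((1 - x) powr (- r) - 1) / r)) * indicator {0<..<1} x"
      using AE_lborel_singleton[of "0::real"] AE_lborel_singleton[of "1::real"]
      by eventually_elim (rule slice)
  qed
  also have "\<dots> = ennreal ((1 - gamma_quot r) / r ^ 2)"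
    by (rule nn_integral_has_integral_lebesgue'[OF _ has_integral_triangle_slices[OF r]]) (rule triangle_slice_nonneg[OF r(1)])
  finally show ?thesis .
qed

text \<open>The exponential series of \<open>- r * ln w\<close>, divided by \<open>w\<close>. At
  \<open>w = 0\<close> both sides are 0 by the conventions for division and
  \<open>powr\<close>.\<close>

lemma neg_ln_power_sums_powr:
  fixes w r :: real
  assumes "w \<ge> 0"
  shows "(\<lambda>n. r ^ n / fact n * ((- ln w) ^ n / w)) sums (w powr (- r - 1))"
proof (cases "w = 0")
  case False
  hence w: "w > 0" using assms by simp
  have "(\<lambda>n. (r * (- ln w)) ^ n / fact n / w) sums (exp (r * (- ln w)) / w)"
    using exp_converges[of "r * (- ln w)"] by (intro sums_divide) (simp add: divide_inverse mult_ac)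
  also have "exp (r * (- ln w)) / w = w powr (- r - 1)"
    using w by (simp add: powr_diff) (simp add: powr_def)
  finally show ?thesis unfolding power_mult_distrib by (simp add: mult_ac)
qed simp

text \<open>All terms of the expansion are nonnegative, so sum and integral may be exchanged in
  \<open>ennreal\<close>, without prior integrability.\<close>

lemma I_int_power_sums:
  assumes r: "0 < r" "r < 1 / 2"
  shows "(\<lambda>n. I_int n * r ^ n / fact n) sums ((1 - gamma_quot r) / r ^ 2)"
proof -
  define f where "f n p = indicator triangleT p * ((- ln (fst p * snd p)) ^ n / (fst p * snd p))"
    for n and p :: "real \<times> real"
  define N where "N n = (\<integral>\<^sup>+p. ennreal (f n p) \<partial>lborel)" for n
  have f_nonneg: "0 \<le> f n p" for n p
  proof (cases "p \<in> triangleT")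
    case True
    hence "0 \<le> fst p * snd p" "fst p * snd p \<le> 1"
      by (auto simp: triangleT_def mult_le_one)
    moreover from this have "ln (fst p * snd p) \<le> 0" by (cases "fst p * snd p = 0") (auto simp: ln_le_zero_iff order_less_le simp del: mult_eq_0_iff)
    ultimately show ?thesis by (auto simp: f_def)
  qed (simp add: f_def)
  have [measurable]: "f n \<in> borel_measurable borel" for n
    unfolding f_def borel_prod[symmetric] by measurable
  have I_eq: "I_int n = enn2real (N n)" for n
  proof -
    have "I_int n = integral\<^sup>L lborel (f n)"
      by (simp add: I_int_def set_lebesgue_integral_def f_def[abs_def])
    also have "\<dots> = enn2real (N n)"
      unfolding N_def by (rule integral_eq_nn_integral) (auto simp: f_nonneg)
    finally show ?thesis .
  qed
  have f_sums: "(\<lambda>n. r ^ n / fact n * f n p) sums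
                  (indicator triangleT p * (fst p * snd p) powr (- r - 1))" for p
    using sums_mult[OF neg_ln_power_sums_powr[of "fst p * snd p" r], of "indicator triangleT p"]
    by (cases "p \<in> triangleT") (auto simp: f_def triangleT_def)
  have "(\<Sum>n. ennreal (r ^ n / fact n) * N n) =
          (\<Sum>n. \<integral>\<^sup>+p. ennreal (r ^ n / fact n * f n p) \<partial>lborel)"
  proof (rule suminf_cong)
    fix n
    have "ennreal (r ^ n / fact n) * N n = (\<integral>\<^sup>+p. ennreal (r ^ n / fact n) * ennreal (f n p) \<partial>lborel)"
      unfolding N_def by (rule nn_integral_cmult[symmetric]) simp
    also have "\<dots> = (\<integral>\<^sup>+p. ennreal (r ^ n / fact n * f n p) \<partial>lborel)"
      using r f_nonneg by (intro nn_integral_cong ennreal_mult[symmetric]) auto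
    finally show "ennreal (r ^ n / fact n) * N n = (\<integral>\<^sup>+p. ennreal (r ^ n / fact n * f n p) \<partial>lborel)" .
  qed
  also have "\<dots> = (\<integral>\<^sup>+p. (\<Sum>n. ennreal (r ^ n / fact n * f n p)) \<partial>lborel)"
    by (rule nn_integral_suminf[symmetric]) simp
  also have "\<dots> = (\<integral>\<^sup>+p. ennreal (indicator triangleT p * (fst p * snd p) powr (- r - 1)) \<partial>lborel)"
  proof (intro nn_integral_cong sums_unique[symmetric])
    fix p
    show "(\<lambda>n. ennreal (r ^ n / fact n * f n p)) sums
            ennreal (indicator triangleT p * (fst p * snd p) powr (- r - 1))"
      using r f_nonneg f_sums[of p] by (subst sums_ennreal) auto
  qed
  also have "\<dots> = ennreal ((1 - gamma_quot r) / r ^ 2)"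
    by (rule nn_integral_triangle_powr[OF r])
  finally have sum_eq: "(\<Sum>n. ennreal (r ^ n / fact n) * N n) = ennreal ((1 - gamma_quot r) / r ^ 2)" .
  \<comment> \<open>Finiteness of the whole sum gives finiteness of each term. Otherwise
    \<open>enn2real\<close> would return 0 and \<open>I_int n\<close> would lose its
    meaning.\<close>
  have N_fin: "N n < top" for n
  proof -
    have "(\<Sum>n. ennreal (r ^ n / fact n) * N n) < top" by (simp add: sum_eq)
    hence "ennreal (r ^ n / fact n) * N n < top" by (rule ennreal_suminf_lessD)
    moreover have "ennreal (r ^ n / fact n) \<noteq> 0" using r by (simp add: ennreal_eq_0_iff not_le)
    ultimately show ?thesis by (auto simp only: ennreal_mult_less_top ennreal_zero_less_top)
  qed
  have "ennreal (r ^ n / fact n) * N n = ennreal (I_int n * r ^ n / fact n)" for n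
    unfolding I_eq using r N_fin[of n] by (cases "N n") (auto simp flip: ennreal_mult simp: mult_ac)
  hence "(\<lambda>n. ennreal (I_int n * r ^ n / fact n)) sums ennreal ((1 - gamma_quot r) / r ^ 2)"
    using summable_sums[OF summableI, of "\<lambda>n. ennreal (r ^ n / fact n) * N n"] sum_eq by simp
  moreover have "(1 - gamma_quot r) / r ^ 2 \<ge> 0"
    by (rule has_integral_nonneg[OF has_integral_triangle_slices[OF r]]) (rule triangle_slice_nonneg[OF r(1)])
  ultimately show ?thesis
    using r by (subst (asm) sums_ennreal) (auto simp: I_eq)
qed

text \<open>The Taylor coefficients of \<open>gamma_quot\<close> at 0; the shift by two comes from
  the denominator \<open>r ^ 2\<close> in the generating function.\<close>

definition gamma_quot_coeff :: "nat \<Rightarrow> real" where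
  "gamma_quot_coeff m = (if m = 0 then 1 else if m = 1 then 0 else - I_int (m - 2) / fact (m - 2))"

lemma gamma_quot_coeff_sums:
  assumes "0 < t" "t < 1 / 2"
  shows "(\<lambda>n. gamma_quot_coeff n * t ^ n) sums gamma_quot t"
proof -
  have "(\<lambda>n. - (t ^ 2) * (I_int n * t ^ n / fact n)) sums (- (t ^ 2) * ((1 - gamma_quot t) / t ^ 2))"
    by (intro sums_mult I_int_power_sums assms)
  hence "(\<lambda>n. gamma_quot_coeff (n + 2) * t ^ (n + 2)) sums (gamma_quot t - 1)"
    using assms by (simp add: gamma_quot_coeff_def power2_eq_square mult_ac)
  thus ?thesis
    by (subst (asm) sums_iff_shift) (simp add: gamma_quot_coeff_def numeral_2_eq_2)
qed

lemma gamma_quot_coeff_Suc: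
  "real (Suc n) * gamma_quot_coeff (Suc n) =
     (\<Sum>j\<le>n. - (2 ^ Suc j - 2) * zeta_nat (Suc j) * gamma_quot_coeff (n - j))"
  by (rule gamma_quot_coeff_rec[OF gamma_quot_coeff_sums])

section \<open>Coefficients of monomials over the rationals\<close>

interpretation rat_real: vector_space "\<lambda>q r. of_rat q * (r :: real)"
  by unfold_locales (simp_all add: algebra_simps of_rat_add of_rat_mult)

definition finsupp :: "(nat \<Rightarrow> nat) set" where
  "finsupp = {e. finite {i. e i \<noteq> 0}}"

text \<open>The product runs over the support of \<open>e\<close>, so that no bound on the number of
  variables has to be carried along.\<close>

definition mono_val :: "(nat \<Rightarrow> real) \<Rightarrow> (nat \<Rightarrow> nat) \<Rightarrow> real" where
  "mono_val x e = (\<Prod>i | e i \<noteq> 0. x i ^ e i)"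

lemma mono_val_superset:
  assumes "finite A" "\<And>i. i \<notin> A \<Longrightarrow> e i = 0"
  shows "mono_val x e = (\<Prod>i\<in>A. x i ^ e i)"
proof -
  have "i \<in> A" if "e i \<noteq> 0" for i using assms(2)[of i] that by auto
  hence "{i. e i \<noteq> 0} \<subseteq> A" by auto
  thus ?thesis unfolding mono_val_def by (rule prod.mono_neutral_left[OF assms(1)]) auto
qed

lemma finsupp_add: "e \<in> finsupp \<Longrightarrow> f \<in> finsupp \<Longrightarrow> (\<lambda>i. e i + f i) \<in> finsupp"
  by (auto simp: finsupp_def Collect_disj_eq)

lemma mono_val_add:
  assumes "e \<in> finsupp" "f \<in> finsupp"
  shows "mono_val x (\<lambda>i. e i + f i) = mono_val x e * mono_val x f"
proof -
  let ?A = "{i. e i \<noteq> 0} \<union> {i. f i \<noteq> 0}"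
  have "finite ?A" using assms by (auto simp: finsupp_def)
  thus ?thesis
    by (subst (1 2 3) mono_val_superset[where A = ?A]) (auto simp: power_add prod.distrib)
qed

text \<open>The reals whose product with \<open>mono_val x e\<close> lies in the target span form a
  subspace, so the generators suffice.\<close>

lemma span_mono_val_mult:
  assumes r: "r \<in> rat_real.span (mono_val x ` A)" and "A \<subseteq> finsupp" and e: "e \<in> finsupp"
    and B: "\<And>f. f \<in> A \<Longrightarrow> (\<lambda>i. e i + f i) \<in> B"
  shows "mono_val x e * r \<in> rat_real.span (mono_val x ` B)"
proof -
  let ?T = "{r. mono_val x e * r \<in> rat_real.span (mono_val x ` B)}"
  have "rat_real.span (mono_val x ` A) \<subseteq> ?T"
  proof (rule rat_real.span_minimal)
    show "mono_val x ` A \<subseteq> ?T"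
    proof safe
      fix f assume f: "f \<in> A"
      have "mono_val x (\<lambda>i. e i + f i) \<in> rat_real.span (mono_val x ` B)"
        by (intro rat_real.span_base imageI B f)
      thus "mono_val x e * mono_val x f \<in> rat_real.span (mono_val x ` B)"
        using f assms by (subst (asm) mono_val_add) auto
    qed
    show "rat_real.subspace ?T"
      unfolding rat_real.subspace_def
    proof (intro conjI ballI allI)
      fix r s assume "r \<in> ?T" "s \<in> ?T"
      thus "r + s \<in> ?T" by (simp add: distrib_left rat_real.span_add)
    next
      fix c r assume "r \<in> ?T"
      hence "of_rat c * (mono_val x e * r) \<in> rat_real.span (mono_val x ` B)"
        using rat_real.span_scale by blast
      thus "of_rat c * r \<in> ?T" by (simp add: mult_ac)
    qed (simp add: rat_real.span_zero)
  qed
  thus ?thesis using r by auto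
qed

text \<open>\<open>r\<close> is a rational combination of monomials in which \<open>X\<close> occurs with coefficient \<open>a\<close>;
  \<open>a\<close> is unique only if the \<open>x i\<close> are algebraically independent.\<close>

definition mono_coeff :: "(nat \<Rightarrow> real) \<Rightarrow> (nat \<Rightarrow> nat) \<Rightarrow> real \<Rightarrow> rat \<Rightarrow> bool" where
  "mono_coeff x X r a \<longleftrightarrow>
     r - of_rat a * mono_val x X \<in> rat_real.span (mono_val x ` (finsupp - {X}))"

lemma mono_coeff_add:
  assumes "mono_coeff x X r a" "mono_coeff x X s b"
  shows "mono_coeff x X (r + s) (a + b)"
proof -
  have "r + s - of_rat (a + b) * mono_val x X =
          (r - of_rat a * mono_val x X) + (s - of_rat b * mono_val x X)"
    by (simp add: of_rat_add algebra_simps)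
  thus ?thesis
    using rat_real.span_add[OF assms[unfolded mono_coeff_def]] by (simp only: mono_coeff_def)
qed

lemma mono_coeff_scale:
  assumes "mono_coeff x X r a"
  shows "mono_coeff x X (of_rat q * r) (q * a)"
proof -
  have "of_rat q * r - of_rat (q * a) * mono_val x X = of_rat q * (r - of_rat a * mono_val x X)"
    by (simp only: of_rat_mult right_diff_distrib mult.assoc)
  thus ?thesis
    using rat_real.span_scale[OF assms[unfolded mono_coeff_def], of q] by (simp only: mono_coeff_def)
qed

lemma mono_coeff_sum:
  assumes "finite A" "\<And>i. i \<in> A \<Longrightarrow> mono_coeff x X (r i) (a i)"
  shows "mono_coeff x X (sum r A) (sum a A)"
  using assms
proof (induction A rule: finite_induct)
  case empty
  show ?case by (simp add: mono_coeff_def rat_real.span_zero)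
next
  case (insert i A)
  show ?case
    unfolding sum.insert[OF insert.hyps]
    by (intro mono_coeff_add insert.IH insert.prems) auto
qed

lemma mono_coeff_mono_val:
  assumes "e \<in> finsupp"
  shows "mono_coeff x X (mono_val x e) (if e = X then 1 else 0)"
  using assms by (auto simp: mono_coeff_def rat_real.span_zero intro: rat_real.span_base)

text \<open>Adding \<open>e\<close> to exponent vectors is injective, so no monomial other than
  \<open>Y\<close> is moved to \<open>e + Y\<close>.\<close>

lemma mono_coeff_mult:
  assumes "mono_coeff x Y r a" "e \<in> finsupp" "Y \<in> finsupp"
  shows "mono_coeff x (\<lambda>i. e i + Y i) (mono_val x e * r) a"
proof -
  let ?X = "\<lambda>i. e i + Y i"
  have "mono_val x e * (r - of_rat a * mono_val x Y) \<in>
          rat_real.span (mono_val x ` (finsupp - {?X}))"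
  proof (rule span_mono_val_mult[OF assms(1)[unfolded mono_coeff_def] _ assms(2)])
    fix f assume "f \<in> finsupp - {Y}"
    thus "(\<lambda>i. e i + f i) \<in> finsupp - {?X}"
      using finsupp_add[OF assms(2), of f] by (auto simp: fun_eq_iff)
  qed auto
  also have "mono_val x e * (r - of_rat a * mono_val x Y) =
               mono_val x e * r - of_rat a * mono_val x ?X"
    unfolding mono_val_add[OF assms(2,3)] by (simp add: right_diff_distrib)
  finally show ?thesis by (simp only: mono_coeff_def)
qed

text \<open>Every monomial of the product is divisible by that of \<open>e\<close>, so
  \<open>X\<close> cannot occur among them.\<close>

lemma mono_coeff_mult_eq_0:
  assumes "r \<in> rat_real.span (mono_val x ` finsupp)" "e \<in> finsupp" "\<not> e \<le> X"
  shows "mono_coeff x X (mono_val x e * r) 0"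
proof -
  have "mono_val x e * r \<in> rat_real.span (mono_val x ` (finsupp - {X}))"
    by (rule span_mono_val_mult[OF assms(1) _ assms(2)])
       (use assms finsupp_add[OF assms(2)] in \<open>auto simp: le_fun_def\<close>)
  thus ?thesis by (simp add: mono_coeff_def)
qed

text \<open>Translates algebraic independence into spans: membership would yield a vanishing
  rational combination with coefficient -1 at \<open>X\<close>.\<close>

lemma mono_val_notin_span:
  assumes indep: "alg_indep_over_rat x" and X: "X \<in> finsupp"
  shows "mono_val x X \<notin> rat_real.span (mono_val x ` (finsupp - {X}))"
proof
  assume "mono_val x X \<in> rat_real.span (mono_val x ` (finsupp - {X}))"
  then obtain t c where t: "finite t" "t \<subseteq> mono_val x ` (finsupp - {X})"
    and eq: "mono_val x X = (\<Sum>v\<in>t. of_rat (c v) * v)"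
    unfolding rat_real.span_explicit by auto
  \<comment> \<open>Different exponent vectors might share a value, so one preimage is chosen for
    each element of \<open>t\<close>.\<close>
  from t(2) obtain U where U: "U \<subseteq> finsupp - {X}" "inj_on (mono_val x) U" "t = mono_val x ` U"
    by (auto simp: subset_image_inj)
  have fin: "finite U" using t U finite_imageD by auto
  define S where "S = (\<Union>e\<in>insert X U. {i. e i \<noteq> 0})"
  have "finite S" using fin X U by (auto simp: S_def finsupp_def)
  then obtain N where N: "\<And>i. i \<in> S \<Longrightarrow> i < N"
    using finite_nat_set_iff_bounded by auto
  have supp: "e i = 0" if "e \<in> insert X U" "i \<ge> N" for e i
    using that N[of i] by (force simp: S_def)
  have val: "mono_val x e = (\<Prod>i<N. x i ^ e i)" if "e \<in> insert X U" for e
    by (rule mono_val_superset) (use supp[OF that] in auto)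
  define d :: "(nat \<Rightarrow> nat) \<Rightarrow> real"
    where "d e = (if e = X then - 1 else of_rat (c (mono_val x e)))" for e
  have "(\<Sum>e\<in>insert X U. d e * (\<Prod>i<N. x i ^ e i)) = (\<Sum>e\<in>insert X U. d e * mono_val x e)"
    by (intro sum.cong refl) (simp add: val)
  also have "\<dots> = - mono_val x X + (\<Sum>e\<in>U. d e * mono_val x e)"
    using fin U(1) by (subst sum.insert) (auto simp: d_def)
  also have "(\<Sum>e\<in>U. d e * mono_val x e) = (\<Sum>e\<in>U. of_rat (c (mono_val x e)) * mono_val x e)"
    using U(1) by (intro sum.cong refl) (auto simp: d_def)
  also have "\<dots> = mono_val x X"
    unfolding eq U(3) by (simp add: sum.reindex[OF U(2)])
  finally have "(\<Sum>e\<in>insert X U. d e * (\<Prod>i<N. x i ^ e i)) = 0" by simp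
  moreover have "\<forall>e\<in>insert X U. d e \<in> \<rat>" by (auto simp: d_def)
  ultimately have "\<forall>e\<in>insert X U. d e = 0"
    using indep[unfolded alg_indep_over_rat_def, rule_format, of "insert X U" N d] fin supp by blast
  thus False by (simp add: d_def)
qed

text \<open>The difference of two representations puts a nonzero multiple of the monomial
  \<open>X\<close> into the span of the others.\<close>

lemma mono_coeff_unique:
  assumes "alg_indep_over_rat x" "X \<in> finsupp" "mono_coeff x X r a" "mono_coeff x X r b"
  shows "a = b"
proof (rule ccontr)
  assume ne: "a \<noteq> b"
  let ?V = "rat_real.span (mono_val x ` (finsupp - {X}))"
  have "(r - of_rat b * mono_val x X) - (r - of_rat a * mono_val x X) \<in> ?V"
    using assms(3,4) unfolding mono_coeff_def by (metis rat_real.span_diff)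
  hence "of_rat (1 / (a - b)) * ((r - of_rat b * mono_val x X) - (r - of_rat a * mono_val x X)) \<in> ?V"
    by (rule rat_real.span_scale)
  also have "(r - of_rat b * mono_val x X) - (r - of_rat a * mono_val x X) =
               of_rat (a - b) * mono_val x X"
    by (simp add: of_rat_diff algebra_simps)
  also have "of_rat (1 / (a - b)) * \<dots> = mono_val x X"
    using ne by (simp flip: mult.assoc of_rat_mult)
  finally show False using mono_val_notin_span[OF assms(1,2)] by blast
qed

section \<open>Zeta values as monomials, and divisibility between them\<close>

text \<open>The exponent vector of \<open>\<zeta>(i)\<close> up to a rational factor: \<open>\<pi>\<close> to the power \<open>i\<close> for even \<open>i\<close>.\<close>

definition zeta_mono :: "nat \<Rightarrow> nat \<Rightarrow> nat" where
  "zeta_mono i = (if even i then (\<lambda>k. if k = 0 then i else 0)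
                  else (\<lambda>k. if k = i div 2 then 1 else 0))"

lemma zeta_mono_finsupp: "zeta_mono i \<in> finsupp"
  by (auto simp: zeta_mono_def finsupp_def)

text \<open>The sign of \<open>q\<close> matters: it later rules out cancellation.\<close>

lemma zeta_nat_mono:
  assumes "i \<ge> 2"
  shows "\<exists>q>0. zeta_nat i = of_rat q * mono_val pi_odd_zetas (zeta_mono i)"
proof (cases "even i")
  case True
  have "mono_val pi_odd_zetas (zeta_mono i) = (\<Prod>k\<in>{0}. pi_odd_zetas k ^ zeta_mono i k)"
    by (rule mono_val_superset) (auto simp: zeta_mono_def True)
  hence val: "mono_val pi_odd_zetas (zeta_mono i) = pi ^ i"
    using True by (simp add: zeta_mono_def pi_odd_zetas_def)
  obtain q where q: "zeta_nat i / pi ^ i = of_rat q"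
    using even_zeta_rat_multiple_pi_power[OF True assms] by (auto elim: Rats_cases)
  have "zeta_nat i / pi ^ i > 0" using zeta_nat_pos[OF assms] by simp
  hence "q > 0" unfolding q by simp
  moreover have "zeta_nat i = of_rat q * mono_val pi_odd_zetas (zeta_mono i)"
    using q by (simp add: val field_simps)
  ultimately show ?thesis by blast
next
  case False
  have "mono_val pi_odd_zetas (zeta_mono i) = (\<Prod>k\<in>{i div 2}. pi_odd_zetas k ^ zeta_mono i k)"
    by (rule mono_val_superset) (auto simp: zeta_mono_def False)
  moreover have "2 * (i div 2) + 1 = i" "i div 2 \<noteq> 0" using False assms by auto
  ultimately have "mono_val pi_odd_zetas (zeta_mono i) = zeta_nat i"
    using False by (simp add: zeta_mono_def pi_odd_zetas_def)
  thus ?thesis by (intro exI[of _ 1]) simp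
qed

text \<open>These indices have a zeta monomial that no zeta monomial of smaller index, from 2 on,
  divides. Even \<open>k\<close> from 4 on fail, since the square of \<open>pi\<close> divides their
  monomial.\<close>

definition zeta_gen :: "nat \<Rightarrow> bool" where
  "zeta_gen k \<longleftrightarrow> k = 2 \<or> odd k \<and> k \<ge> 3"

lemma zeta_mono_le_gen:
  assumes "zeta_gen k" "2 \<le> i" "i \<le> k" "zeta_mono i \<le> zeta_mono k"
  shows "i = k"
  using assms(1-3) le_funD[OF assms(4), of "if even i then 0 else i div 2"]
  by (auto simp: zeta_gen_def zeta_mono_def elim!: oddE split: if_splits)

text \<open>Compares exponents at the only variable of \<open>zeta_mono i\<close>. Requiring
  \<open>odd q\<close> excludes \<open>p = q = 2\<close>, where \<open>i = 4\<close> would also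
  divide.\<close>

lemma zeta_mono_le_gen_prod:
  assumes "zeta_gen p" "zeta_gen q" "odd q" "2 \<le> i"
    and "zeta_mono i \<le> (\<lambda>k. zeta_mono p k + zeta_mono q k)"
  shows "i = p \<or> i = q"
  using assms(1-4) le_funD[OF assms(5), of "if even i then 0 else i div 2"]
  by (auto simp: zeta_gen_def zeta_mono_def elim!: oddE split: if_splits)

section \<open>Signs of monomial coefficients along the recurrence\<close>

locale gamma_quot_rec =
  fixes w :: "nat \<Rightarrow> rat"
  assumes w_pos: "i \<ge> 2 \<Longrightarrow> w i > 0"
    and w: "i \<ge> 2 \<Longrightarrow> (2 ^ i - 2) * zeta_nat i = of_rat (w i) * mono_val pi_odd_zetas (zeta_mono i)"
begin

lemma coeff_rec:
  assumes "n > 0"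
  shows "gamma_quot_coeff n = of_rat (1 / of_nat n) *
    (\<Sum>i\<in>{2..n}. of_rat (- w i) * (mono_val pi_odd_zetas (zeta_mono i) * gamma_quot_coeff (n - i)))"
proof -
  obtain m where n: "n = Suc m" using assms by (cases n) auto
  have "real n * gamma_quot_coeff n =
          (\<Sum>j\<le>m. - (2 ^ Suc j - 2) * zeta_nat (Suc j) * gamma_quot_coeff (m - j))"
    unfolding n by (rule gamma_quot_coeff_Suc)
  also have "\<dots> = (\<Sum>i\<in>{1..n}. - ((2 ^ i - 2) * zeta_nat i) * gamma_quot_coeff (n - i))"
    by (rule sum.reindex_bij_witness[of _ "\<lambda>i. i - 1" Suc]) (auto simp: n algebra_simps)
  \<comment> \<open>The term \<open>i = 1\<close> vanishes because
    \<open>2 ^ 1 - 2 = 0\<close>.\<close>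
  also have "\<dots> = (\<Sum>i\<in>{2..n}. - ((2 ^ i - 2) * zeta_nat i) * gamma_quot_coeff (n - i))"
    by (rule sum.mono_neutral_right) (auto simp: not_le less_2_cases_iff)
  also have "\<dots> = (\<Sum>i\<in>{2..n}. of_rat (- w i) *
                    (mono_val pi_odd_zetas (zeta_mono i) * gamma_quot_coeff (n - i)))"
    by (intro sum.cong refl) (simp add: w of_rat_minus)
  finally show ?thesis using assms by (simp add: of_rat_divide field_simps)
qed

lemma coeff_in_span: "gamma_quot_coeff n \<in> rat_real.span (mono_val pi_odd_zetas ` finsupp)"
proof (induction n rule: less_induct)
  case (less n)
  show ?case
  proof (cases "n = 0")
    case True
    have "mono_val pi_odd_zetas (\<lambda>_. 0) \<in> rat_real.span (mono_val pi_odd_zetas ` finsupp)"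
      by (intro rat_real.span_base imageI) (simp add: finsupp_def)
    thus ?thesis using True by (simp add: gamma_quot_coeff_def mono_val_def)
  next
    case False
    hence "n > 0" by simp
    show ?thesis
      unfolding coeff_rec[OF \<open>n > 0\<close>]
      by (intro rat_real.span_scale rat_real.span_sum
            span_mono_val_mult[OF less.IH, of _ _ finsupp] zeta_mono_finsupp finsupp_add) auto
  qed
qed

text \<open>By divisibility only the term \<open>i = k\<close> of the recurrence contributes; there
  \<open>gamma_quot_coeff 0 = 1\<close>, which leaves \<open>- w k / k\<close>.\<close>

lemma coeff_gen:
  assumes "zeta_gen k"
  shows "\<exists>a<0. mono_coeff pi_odd_zetas (zeta_mono k) (gamma_quot_coeff k) a"
proof -
  have k: "k \<ge> 2" using assms by (auto simp: zeta_gen_def)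
  have "mono_coeff pi_odd_zetas (zeta_mono k)
          (mono_val pi_odd_zetas (zeta_mono i) * gamma_quot_coeff (k - i)) (if i = k then 1 else 0)"
    if i: "i \<in> {2..k}" for i
  proof (cases "i = k")
    case True
    thus ?thesis using mono_coeff_mono_val[OF zeta_mono_finsupp[of k], of pi_odd_zetas "zeta_mono k"]
      by (simp add: gamma_quot_coeff_def)
  next
    case False
    hence "\<not> zeta_mono i \<le> zeta_mono k" using zeta_mono_le_gen[OF assms, of i] i by auto
    thus ?thesis using False by (simp add: mono_coeff_mult_eq_0 coeff_in_span zeta_mono_finsupp)
  qed
  hence "mono_coeff pi_odd_zetas (zeta_mono k) (gamma_quot_coeff k)
           (1 / of_nat k * (\<Sum>i\<in>{2..k}. - w i * (if i = k then 1 else 0)))"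
    using k by (subst coeff_rec, simp) (intro mono_coeff_scale mono_coeff_sum finite_atLeastAtMost)
  also have "(\<Sum>i\<in>{2..k}. - w i * (if i = k then 1 else 0)) = - w k"
    using k by (simp add: if_distrib[of "\<lambda>x. _ * x"] cong: if_cong)
  finally show ?thesis using w_pos[OF k] k by (intro exI[of _ "1 / of_nat k * - w k"]) auto
qed

text \<open>Only \<open>i = p\<close> and \<open>i = q\<close> contribute. Each contribution is
  \<open>- w i\<close> times the negative coefficient of the complementary generator, so both are
  positive and cannot cancel.\<close>

lemma coeff_gen_prod:
  assumes gen: "zeta_gen p" "zeta_gen q" "odd q"
  defines "X \<equiv> \<lambda>k. zeta_mono p k + zeta_mono q k"
  shows "\<exists>a>0. mono_coeff pi_odd_zetas X (gamma_quot_coeff (p + q)) a"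
proof -
  have pq: "p \<ge> 2" "q \<ge> 2" using gen by (auto simp: zeta_gen_def)
  let ?t = "\<lambda>i. of_rat (- w i) * (mono_val pi_odd_zetas (zeta_mono i) * gamma_quot_coeff (p + q - i))"
  have gen_term: "\<exists>a>0. mono_coeff pi_odd_zetas X (?t i) a"
    if i: "i + j = p + q" "zeta_gen j" "i \<ge> 2" "X = (\<lambda>k. zeta_mono i k + zeta_mono j k)" for i j
  proof -
    obtain a where a: "a < 0" "mono_coeff pi_odd_zetas (zeta_mono j) (gamma_quot_coeff j) a"
      using coeff_gen[OF i(2)] by blast
    have "p + q - i = j" using i(1) by simp
    hence "mono_coeff pi_odd_zetas X (?t i) (- w i * a)"
      unfolding i(4) using a(2) by (intro mono_coeff_scale) (simp add: mono_coeff_mult zeta_mono_finsupp)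
    moreover have "- w i * a > 0" using a(1) w_pos[OF i(3)] by (simp add: mult_pos_neg)
    ultimately show ?thesis by blast
  qed
  have main: "\<exists>a>0. mono_coeff pi_odd_zetas X (?t i) a" if "i = p \<or> i = q" for i
    using that gen_term[of p q] gen_term[of q p] gen pq by (auto simp: X_def add.commute)
  have "\<exists>a\<ge>0. mono_coeff pi_odd_zetas X (?t i) a \<and> (i = p \<longrightarrow> a > 0)" if i: "i \<in> {2..p + q}" for i
  proof (cases "i = p \<or> i = q")
    case True
    thus ?thesis using main[of i] by (meson less_imp_le)
  next
    case False
    hence "\<not> zeta_mono i \<le> X" using zeta_mono_le_gen_prod[OF gen, of i] i by (auto simp: X_def)
    hence "mono_coeff pi_odd_zetas X (?t i) (- w i * 0)"
      by (intro mono_coeff_scale mono_coeff_mult_eq_0 coeff_in_span zeta_mono_finsupp)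
    thus ?thesis using False by auto
  qed
  then obtain a where a: "\<And>i. i \<in> {2..p + q} \<Longrightarrow>
      a i \<ge> 0 \<and> mono_coeff pi_odd_zetas X (?t i) (a i) \<and> (i = p \<longrightarrow> a i > 0)"
    by metis
  have "mono_coeff pi_odd_zetas X (gamma_quot_coeff (p + q)) (1 / of_nat (p + q) * sum a {2..p + q})"
    using pq a
    by (subst coeff_rec, simp) (intro mono_coeff_scale mono_coeff_sum finite_atLeastAtMost, blast)
  moreover have "sum a {2..p + q} > 0"
    by (rule sum_pos2[where i = p]) (use a a[of p] pq in auto)
  hence "1 / of_nat (p + q) * sum a {2..p + q} > 0" using pq by simp
  ultimately show ?thesis by blast
qed

lemma not_rat_multiple_zeta:
  assumes indep: "alg_indep_over_rat pi_odd_zetas"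
    and gen: "zeta_gen p" "zeta_gen q" "odd q"
  shows "gamma_quot_coeff (p + q) \<noteq> of_rat r * zeta_nat (p + q)"
proof
  assume eq: "gamma_quot_coeff (p + q) = of_rat r * zeta_nat (p + q)"
  define X where "X = (\<lambda>k. zeta_mono p k + zeta_mono q k)"
  have pq: "p \<ge> 2" "q \<ge> 2" using gen by (auto simp: zeta_gen_def)
  \<comment> \<open>Equality would make \<open>zeta_mono (p + q)\<close> divide \<open>X\<close>,
    forcing \<open>p + q\<close> to be \<open>p\<close> or \<open>q\<close>.\<close>
  hence "zeta_mono (p + q) \<noteq> X"
    using zeta_mono_le_gen_prod[OF gen, of "p + q"] by (auto simp: X_def)
  moreover obtain s where "zeta_nat (p + q) = of_rat s * mono_val pi_odd_zetas (zeta_mono (p + q))"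
    using zeta_nat_mono[of "p + q"] pq by auto
  moreover have "mono_coeff pi_odd_zetas X (of_rat r * (of_rat s * mono_val pi_odd_zetas (zeta_mono (p + q))))
          (r * (s * (if zeta_mono (p + q) = X then 1 else 0)))"
    by (intro mono_coeff_scale mono_coeff_mono_val zeta_mono_finsupp)
  ultimately have "mono_coeff pi_odd_zetas X (gamma_quot_coeff (p + q)) 0" by (simp add: eq)
  moreover obtain a where "a > 0" "mono_coeff pi_odd_zetas X (gamma_quot_coeff (p + q)) a"
    using coeff_gen_prod[OF gen] by (auto simp: X_def)
  moreover have "X \<in> finsupp" unfolding X_def by (intro finsupp_add zeta_mono_finsupp)
  ultimately show False using mono_coeff_unique[OF indep] by blast
qed

end

theorem theorem2:
  fixes n :: nat
  assumes "alg_indep_over_rat pi_odd_zetas"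
    and "n > 2"
  shows "\<not> (\<exists>q \<in> \<rat>. I_int n = q * zeta_nat (n + 2))"
proof
  assume "\<exists>q \<in> \<rat>. I_int n = q * zeta_nat (n + 2)"
  then obtain r where r: "I_int n = of_rat r * zeta_nat (n + 2)" by (auto elim: Rats_cases)
  have "\<exists>c>0. (2 ^ i - 2) * zeta_nat i = of_rat c * mono_val pi_odd_zetas (zeta_mono i)" if i: "i \<ge> 2" for i
  proof -
    obtain c where c: "c > 0" "zeta_nat i = of_rat c * mono_val pi_odd_zetas (zeta_mono i)"
      using zeta_nat_mono[OF i] by blast
    have "(2::rat) ^ 1 < 2 ^ i" using i by (intro power_strict_increasing) auto
    thus ?thesis using c
      by (intro exI[of _ "(2 ^ i - 2) * c"]) (auto simp: of_rat_mult of_rat_diff of_rat_power)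
  qed
  then obtain w where "\<And>i. i \<ge> 2 \<Longrightarrow> w i > 0 \<and>
      (2 ^ i - 2) * zeta_nat i = of_rat (w i) * mono_val pi_odd_zetas (zeta_mono i)"
    by metis
  then interpret gamma_quot_rec w by unfold_locales auto
  \<comment> \<open>Odd \<open>n\<close> uses the product for zeta(2) and zeta(n), even
    \<open>n\<close> the one for zeta(3) and zeta(n - 1). As \<open>n > 2\<close>, the second index
    is odd and at least 3.\<close>
  obtain p q where pq: "zeta_gen p" "zeta_gen q" "odd q" "n + 2 = p + q"
  proof (cases "even n")
    case True
    hence "n \<ge> 4" using assms(2) by presburger
    hence "zeta_gen 3" "zeta_gen (n - 1)" "odd (n - 1)" "n + 2 = 3 + (n - 1)"
      using True by (auto simp: zeta_gen_def)
    thus ?thesis by (rule that)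
  next
    case False
    thus ?thesis using that[of 2 n] assms(2) by (auto simp: zeta_gen_def)
  qed
  have of_rat_fact: "of_rat (fact n) = (fact n :: real)"
    by (metis of_nat_fact of_rat_of_nat_eq)
  have "gamma_quot_coeff (n + 2) = of_rat (- r / fact n) * zeta_nat (n + 2)"
    by (simp add: gamma_quot_coeff_def r of_rat_divide of_rat_minus of_rat_fact)
  thus False using not_rat_multiple_zeta[OF assms(1) pq(1-3)] pq(4) by metis
qed

end
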